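(* Let $D\subseteq L\subseteq\mathbb{R}^+$ be such that (i) either $D$ has no maximum or there is $\ell\in L$ with $\ell>\max D$, and (ii) either $\inf D=0$ or there is $\ell\in L$ with $\ell\le\inf D$. Define $\mathbf{F}\colon\mathbf{U}_D\to\mathbf{T}_L^{\mathrm{pr}}$ as follows: for $(U,d)\in\mathbf{U}_D$, $\mathbf{F}(U)=(T,\le_T,\lambda_T)$ with $T=\{(B,\ell):\ell\in L,\ B=B_d(x,\ell)\text{ for some }x\in U\}$, $(B,\ell)\le_T(B',\ell')\iff\ell\le\ell'\wedge B\subseteq B'$, $\lambda_T(B,\ell)=\ell$; and for an isometric embedding $\psi\colon(U,d)\to(U',d')$, $\mathbf{F}(\psi)(B,\ell)=(B_{d'}(\psi(x),\ell),\ell)$ for any $x\in B$. Then $\mathbf{F}$ is a categorical full embedding such that $|\mathbf{F}(U)|\le\operatorname{weight}(U)\cdot|L|$ for every $U\in\mathbf{U}_D$.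
   Context: $B_d(x,\ell)=\{y:d(x,y)<\ell\}$. $\mathbf{U}_D$ is the category of nonempty complete ultrametric spaces whose distance set $\{d(x,y)\}\setminus\{0\}$ is contained in $D$, with isometric embeddings as arrows. For a linear order $L$, an $L$-tree is $(T,\le_T,\lambda_T)$ with $(T,\le_T)$ a partial order and $\lambda_T\colon T\to L$ surjective such that for all $t,t'$: (1) $t<_Tt'$ implies $\lambda_T(t)<\lambda_T(t')$; (2) for every $\ell\ge\lambda_T(t)$ there is a unique $t''\ge_Tt$ with $\lambda_T(t'')=\ell$; (3) $t$ and $t'$ have a common element above them at some level $\ell\ge\max\{\lambda_T(t),\lambda_T(t')\}$; (4) if $t,t'$ are incomparable, the set of levels $\ell\ge\max\{\lambda_T(t),\lambda_T(t')\}$ at which the elements above $t$ and $t'$ differ has a maximum. It is pruned if every node lies on a branch, i.e. on a map $b\colon L\to T$ with $\lambda_T(b(\ell))=\ell$ and $b$ monotone. $\mathbf{T}_L^{\mathrm{pr}}$ is the category of pruned $L$-trees with embeddings (injections $f$ with $\lambda(f(t))=\lambda(t)$ and $t\le t'\iff f(t)\le f(t')$) as arrows. A categorical full embedding is a faithful, full functor injective on objects. *)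

theory Defs
  imports "HOL-Analysis.Analysis"
begin

unbundle cardinal_syntax

definition is_max :: "'a::linorder \<Rightarrow> 'a set \<Rightarrow> bool" where
  "is_max m S \<longleftrightarrow> m \<in> S \<and> (\<forall>s\<in>S. s \<le> m)"


section \<open>Categories and full embeddings\<close>

text \<open>Arrows are given by hom-sets indexed by source and target, so the same element may serve as
  an arrow between different pairs of objects; composition and the action of a functor on arrows
  therefore take the objects as arguments. \<open>Comp C X Y Z g f\<close> is the composite of
  \<open>f : X \<rightarrow> Y\<close> and \<open>g : Y \<rightarrow> Z\<close>.\<close>

record ('o, 'm) cat =
  Ob :: "'o set"
  Hom :: "'o \<Rightarrow> 'o \<Rightarrow> 'm set"
  Ident :: "'o \<Rightarrow> 'm"
  Comp :: "'o \<Rightarrow> 'o \<Rightarrow> 'o \<Rightarrow> 'm \<Rightarrow> 'm \<Rightarrow> 'm"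

locale category =
  fixes C :: "('o, 'm) cat"
  assumes Ident_in_Hom: "X \<in> Ob C \<Longrightarrow> Ident C X \<in> Hom C X X"
    and Comp_in_Hom:
      "\<lbrakk>X \<in> Ob C; Y \<in> Ob C; Z \<in> Ob C; f \<in> Hom C X Y; g \<in> Hom C Y Z\<rbrakk>
        \<Longrightarrow> Comp C X Y Z g f \<in> Hom C X Z"
    and Comp_Ident_right:
      "\<lbrakk>X \<in> Ob C; Y \<in> Ob C; f \<in> Hom C X Y\<rbrakk> \<Longrightarrow> Comp C X X Y f (Ident C X) = f"
    and Comp_Ident_left:
      "\<lbrakk>X \<in> Ob C; Y \<in> Ob C; f \<in> Hom C X Y\<rbrakk> \<Longrightarrow> Comp C X Y Y (Ident C Y) f = f"
    and Comp_assoc: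
      "\<lbrakk>W \<in> Ob C; X \<in> Ob C; Y \<in> Ob C; Z \<in> Ob C;
        f \<in> Hom C W X; g \<in> Hom C X Y; h \<in> Hom C Y Z\<rbrakk>
        \<Longrightarrow> Comp C W Y Z h (Comp C W X Y g f) = Comp C W X Z (Comp C X Y Z h g) f"

locale cat_functor = source: category C + target: category D
  for C :: "('o1, 'm1) cat" and D :: "('o2, 'm2) cat" +
  fixes Fo :: "'o1 \<Rightarrow> 'o2" and Fa :: "'o1 \<Rightarrow> 'o1 \<Rightarrow> 'm1 \<Rightarrow> 'm2"
  assumes Fo_in_Ob: "X \<in> Ob C \<Longrightarrow> Fo X \<in> Ob D"
    and Fa_in_Hom:
      "\<lbrakk>X \<in> Ob C; Y \<in> Ob C; f \<in> Hom C X Y\<rbrakk> \<Longrightarrow> Fa X Y f \<in> Hom D (Fo X) (Fo Y)"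
    and Fa_Ident: "X \<in> Ob C \<Longrightarrow> Fa X X (Ident C X) = Ident D (Fo X)"
    and Fa_Comp:
      "\<lbrakk>X \<in> Ob C; Y \<in> Ob C; Z \<in> Ob C; f \<in> Hom C X Y; g \<in> Hom C Y Z\<rbrakk>
        \<Longrightarrow> Fa X Z (Comp C X Y Z g f)
          = Comp D (Fo X) (Fo Y) (Fo Z) (Fa Y Z g) (Fa X Y f)"

locale categorical_full_embedding = cat_functor C D Fo Fa
  for C :: "('o1, 'm1) cat" and D :: "('o2, 'm2) cat"
    and Fo :: "'o1 \<Rightarrow> 'o2" and Fa :: "'o1 \<Rightarrow> 'o1 \<Rightarrow> 'm1 \<Rightarrow> 'm2" +
  assumes faithful: "\<lbrakk>X \<in> Ob C; Y \<in> Ob C\<rbrakk> \<Longrightarrow> inj_on (Fa X Y) (Hom C X Y)"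
    and full:
      "\<lbrakk>X \<in> Ob C; Y \<in> Ob C; k \<in> Hom D (Fo X) (Fo Y)\<rbrakk> \<Longrightarrow> \<exists>f\<in>Hom C X Y. Fa X Y f = k"
    and inj_objects: "inj_on Fo (Ob C)"


section \<open>Complete ultrametric spaces with prescribed distances\<close>

text \<open>The distance function of an \<^typ>\<open>'a metric\<close> is also defined off the carrier, where its values
  are irrelevant. Requiring them to be zero makes equality of objects coincide with
  equality of carriers and of distances on the carrier; without it, injectivity of a functor on
  objects would be spoiled by junk values.\<close>

definition ultrametric_spaces :: "real set \<Rightarrow> 'a metric set" where
  "ultrametric_spaces D = {U.
     mspace U \<noteq> {} \<and>
     mcomplete_of U \<and>
     (\<forall>x\<in>mspace U. \<forall>y\<in>mspace U. \<forall>z\<in>mspace U.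
        mdist U x z \<le> max (mdist U x y) (mdist U y z)) \<and>
     {mdist U x y | x y. x \<in> mspace U \<and> y \<in> mspace U} - {0} \<subseteq> D \<and>
     (\<forall>x y. x \<notin> mspace U \<or> y \<notin> mspace U \<longrightarrow> mdist U x y = 0)}"

definition isometric_embeddings :: "'a metric \<Rightarrow> 'a metric \<Rightarrow> ('a \<Rightarrow> 'a) set" where
  "isometric_embeddings U V = {\<psi>. \<psi> \<in> mspace U \<rightarrow>\<^sub>E mspace V \<and>
     (\<forall>x\<in>mspace U. \<forall>y\<in>mspace U. mdist V (\<psi> x) (\<psi> y) = mdist U x y)}"

definition U_cat :: "real set \<Rightarrow> ('a metric, 'a \<Rightarrow> 'a) cat" where
  "U_cat D = \<lparr>Ob = ultrametric_spaces D,
     Hom = isometric_embeddings,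
     Ident = (\<lambda>U. restrict id (mspace U)),
     Comp = (\<lambda>U V W g f. compose (mspace U) g f)\<rparr>"


section \<open>Pruned trees over a linear order\<close>

record ('t, 'l) leveled_order =
  nodes :: "'t set"
  tord :: "'t rel"
  level :: "'t \<Rightarrow> 'l"

text \<open>The (unique, in a tree) element above \<open>t\<close> at level \<open>l\<close>.\<close>

definition node_above :: "('t, 'l) leveled_order \<Rightarrow> 't \<Rightarrow> 'l \<Rightarrow> 't" where
  "node_above T t l = (THE s. s \<in> nodes T \<and> (t, s) \<in> tord T \<and> level T s = l)"

text \<open>The linear order \<open>L\<close> is a subset of a linearly ordered type. As for metric spaces, the order
  relation lives on the nodes only and the level map is extensional, so that equality of
  records is equality of trees.\<close>

definition is_tree :: "'l::linorder set \<Rightarrow> ('t, 'l) leveled_order \<Rightarrow> bool" where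
  "is_tree L T \<longleftrightarrow>
     partial_order_on (nodes T) (tord T) \<and>
     level T \<in> extensional (nodes T) \<and>
     level T ` nodes T = L \<and>
     (\<forall>t\<in>nodes T. \<forall>t'\<in>nodes T. (t, t') \<in> tord T \<and> t \<noteq> t' \<longrightarrow> level T t < level T t') \<and>
     (\<forall>t\<in>nodes T. \<forall>l\<in>L. level T t \<le> l \<longrightarrow>
        (\<exists>!t''. t'' \<in> nodes T \<and> (t, t'') \<in> tord T \<and> level T t'' = l)) \<and>
     (\<forall>t\<in>nodes T. \<forall>t'\<in>nodes T. \<exists>l\<in>L. max (level T t) (level T t') \<le> l \<and>
        (\<exists>s\<in>nodes T. (t, s) \<in> tord T \<and> (t', s) \<in> tord T \<and> level T s = l)) \<and>
     (\<forall>t\<in>nodes T. \<forall>t'\<in>nodes T. (t, t') \<notin> tord T \<and> (t', t) \<notin> tord T \<longrightarrow>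
        (\<exists>m. is_max m {l\<in>L. max (level T t) (level T t') \<le> l \<and>
                            node_above T t l \<noteq> node_above T t' l}))"

definition is_branch :: "'l::linorder set \<Rightarrow> ('t, 'l) leveled_order \<Rightarrow> ('l \<Rightarrow> 't) \<Rightarrow> bool" where
  "is_branch L T b \<longleftrightarrow> b \<in> L \<rightarrow> nodes T \<and> (\<forall>l\<in>L. level T (b l) = l) \<and>
     (\<forall>l\<in>L. \<forall>l'\<in>L. l \<le> l' \<longrightarrow> (b l, b l') \<in> tord T)"

definition pruned :: "'l::linorder set \<Rightarrow> ('t, 'l) leveled_order \<Rightarrow> bool" where
  "pruned L T \<longleftrightarrow> (\<forall>t\<in>nodes T. \<exists>b. is_branch L T b \<and> t \<in> b ` L)"

definition tree_embeddings ::
    "('t, 'l) leveled_order \<Rightarrow> ('t, 'l) leveled_order \<Rightarrow> ('t \<Rightarrow> 't) set" where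
  "tree_embeddings T T' = {f. f \<in> nodes T \<rightarrow>\<^sub>E nodes T' \<and> inj_on f (nodes T) \<and>
     (\<forall>t\<in>nodes T. level T' (f t) = level T t) \<and>
     (\<forall>t\<in>nodes T. \<forall>s\<in>nodes T. (t, s) \<in> tord T \<longleftrightarrow> (f t, f s) \<in> tord T')}"

definition T_pr_cat :: "'l::linorder set \<Rightarrow> (('t, 'l) leveled_order, 't \<Rightarrow> 't) cat" where
  "T_pr_cat L = \<lparr>Ob = {T. is_tree L T \<and> pruned L T},
     Hom = tree_embeddings,
     Ident = (\<lambda>T. restrict id (nodes T)),
     Comp = (\<lambda>T T' T'' g f. compose (nodes T) g f)\<rparr>"


section \<open>The functor from ultrametric spaces to trees\<close>

definition ball_nodes :: "real set \<Rightarrow> 'a metric \<Rightarrow> ('a set \<times> real) set" where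
  "ball_nodes L U = {(B, l). l \<in> L \<and> (\<exists>x\<in>mspace U. B = mball_of U x l)}"

definition F_obj :: "real set \<Rightarrow> 'a metric \<Rightarrow> ('a set \<times> real, real) leveled_order" where
  "F_obj L U = \<lparr>nodes = ball_nodes L U,
     tord = {((B, l), (B', l')). (B, l) \<in> ball_nodes L U \<and> (B', l') \<in> ball_nodes L U \<and>
               l \<le> l' \<and> B \<subseteq> B'},
     level = restrict snd (ball_nodes L U)\<rparr>"

text \<open>The point of \<open>B\<close> used here is chosen arbitrarily; that the value does not depend on it is
  a claim to be proved.\<close>

definition F_arr :: "real set \<Rightarrow> 'a metric \<Rightarrow> 'a metric \<Rightarrow> ('a \<Rightarrow> 'a)
    \<Rightarrow> 'a set \<times> real \<Rightarrow> 'a set \<times> real" where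
  "F_arr L U V \<psi> =
     restrict (\<lambda>(B, l). (mball_of V (\<psi> (SOME x. x \<in> B)) l, l)) (ball_nodes L U)"


section \<open>Weight of a topological space\<close>

definition base_of :: "'a topology \<Rightarrow> 'a set set \<Rightarrow> bool" where
  "base_of X \<B> \<longleftrightarrow> (\<forall>V\<in>\<B>. openin X V) \<and>
     (\<forall>W x. openin X W \<and> x \<in> W \<longrightarrow> (\<exists>V\<in>\<B>. x \<in> V \<and> V \<subseteq> W))"

text \<open>The least cardinality of a base. A cardinal is represented by a cardinal well-order, so it is
  determined up to order isomorphism only. The weight of a finite discrete space is finite.\<close>

definition weight :: "'a topology \<Rightarrow> 'a set rel" where
  "weight X = (SOME w. w \<in> card_of ` {\<B>. base_of X \<B>} \<and>
                       (\<forall>w' \<in> card_of ` {\<B>. base_of X \<B>}. w \<le>o w'))"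

lemma weight_least_base:
  obtains \<B> where "base_of X \<B>" "weight X = |\<B>|" "\<And>\<B>'. base_of X \<B>' \<Longrightarrow> |\<B>| \<le>o |\<B>'|"
proof -
  let ?R = "card_of ` {\<B>. base_of X \<B>}"
  have "base_of X {V. openin X V}"
    unfolding base_of_def by blast
  then have "?R \<noteq> {}"
    by blast
  moreover have "\<forall>r\<in>?R. Card_order r"
    by (auto simp: card_of_Card_order)
  ultimately have "\<exists>w. w \<in> ?R \<and> (\<forall>w'\<in>?R. w \<le>o w')"
    using exists_minim_Card_order[of ?R] by blast
  then have "weight X \<in> ?R \<and> (\<forall>w'\<in>?R. weight X \<le>o w')"
    unfolding weight_def by (rule someI_ex)
  then show thesis
    using that by auto
qed

end

theory Submission
  imports Defs
begin

text \<open>In an ultrametric space every point of a ball is a centre of it, so the order between the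
  nodes given by balls around \<open>x\<close> and \<open>y\<close> is governed by the comparisons of \<open>d x y\<close> with the
  levels. Since all nonzero distances are levels, these comparisons determine \<open>d x y\<close>. Fullness
  follows: an embedding of trees sends the balls around a point \<open>x\<close> to a chain of balls, which by
  completeness has a common centre, and this centre is the image of \<open>x\<close>. Assumption (ii) ensures
  that the balls of such a chain become small.\<close>

section \<open>The two categories\<close>

lemma metric_eqI:
  assumes "mspace U = mspace V" and "mdist U = mdist V"
  shows "U = V"
  by (metis assms metric_collapse)

lemma mdist_self [simp]: "x \<in> mspace U \<Longrightarrow> mdist U x x = 0"
  by simp

lemma category_ultrametric_spaces: "category (U_cat D)"
  by unfold_locales
    (auto simp: U_cat_def isometric_embeddings_def compose_def restrict_def PiE_iff
      extensional_def fun_eq_iff)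

lemma category_pruned_trees: "category (T_pr_cat L)"
  by unfold_locales
    (auto simp: T_pr_cat_def tree_embeddings_def compose_def restrict_def PiE_iff
      extensional_def fun_eq_iff inj_on_def)

lemma isometric_embeddings_in:
  "\<psi> \<in> isometric_embeddings U V \<Longrightarrow> x \<in> mspace U \<Longrightarrow> \<psi> x \<in> mspace V"
  by (auto simp: isometric_embeddings_def)

lemma isometric_embeddings_dist:
  "\<psi> \<in> isometric_embeddings U V \<Longrightarrow> x \<in> mspace U \<Longrightarrow> y \<in> mspace U
    \<Longrightarrow> mdist V (\<psi> x) (\<psi> y) = mdist U x y"
  by (auto simp: isometric_embeddings_def)

section \<open>Balls in an ultrametric space\<close>

context
  fixes U :: "'a metric" and D
  assumes U: "U \<in> ultrametric_spaces D"
begin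

lemma ultrametric_nonempty: "mspace U \<noteq> {}"
  and ultrametric_complete: "mcomplete_of U"
  and ultrametric_ineq: "x \<in> mspace U \<Longrightarrow> y \<in> mspace U \<Longrightarrow> z \<in> mspace U
        \<Longrightarrow> mdist U x z \<le> max (mdist U x y) (mdist U y z)"
  and ultrametric_dist_in: "x \<in> mspace U \<Longrightarrow> y \<in> mspace U \<Longrightarrow> mdist U x y \<noteq> 0 \<Longrightarrow> mdist U x y \<in> D"
  and ultrametric_dist_off: "x \<notin> mspace U \<or> y \<notin> mspace U \<Longrightarrow> mdist U x y = 0"
  using U unfolding ultrametric_spaces_def by blast+

text \<open>The left-to-right direction tests the inclusion on the centre \<open>x\<close> alone,
  which lies in its own ball as \<open>r\<close> is positive. Conversely both
  \<open>mdist U x y\<close> and the distance from \<open>x\<close> to a point of the smaller ball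
  are below \<open>s\<close>, and so is their maximum.\<close>

lemma mball_subset_iff:
  assumes "0 < r" and "r \<le> s" and "x \<in> mspace U" and "y \<in> mspace U"
  shows "mball_of U x r \<subseteq> mball_of U y s \<longleftrightarrow> mdist U x y < s"
proof
  assume "mball_of U x r \<subseteq> mball_of U y s"
  moreover have "x \<in> mball_of U x r"
    using assms by simp
  ultimately have "x \<in> mball_of U y s"
    by blast
  then show "mdist U x y < s"
    by (simp add: mdist_commute)
next
  assume s: "mdist U x y < s"
  show "mball_of U x r \<subseteq> mball_of U y s"
  proof
    fix z
    assume z: "z \<in> mball_of U x r"
    then have "mdist U y z \<le> max (mdist U y x) (mdist U x z)"
      using assms by (intro ultrametric_ineq) auto
    then show "z \<in> mball_of U y s"
      using z s assms mdist_commute[of U x y] by auto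
  qed
qed

lemma mball_eq_iff:
  assumes "0 < r" and "x \<in> mspace U" and "y \<in> mspace U"
  shows "mball_of U x r = mball_of U y r \<longleftrightarrow> mdist U x y < r"
  using mball_subset_iff[of r r x y] mball_subset_iff[of r r y x] assms
  by (auto simp: set_eq_subset mdist_commute[of U y x])

lemma mball_eqI:
  assumes "0 < r" and "x \<in> mspace U" and "z \<in> mball_of U x r"
  shows "mball_of U x r = mball_of U z r"
  using assms mball_eq_iff by simp

text \<open>Two balls of the same radius coincide as soon as they meet, so the ball of radius
  \<open>r\<close> around a point outside misses the given ball. Closedness is what the intersection
  form of completeness asks of the members of a chain of balls.\<close>

lemma closedin_mball_of:
  assumes "0 < r" and "x \<in> mspace U"
  shows "closedin (mtopology_of U) (mball_of U x r)"
proof -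
  interpret Metric_space "mspace U" "mdist U"
    by (rule Metric_space_mspace_mdist)
  have "disjnt (mball_of U x r) (mball y r)" if "y \<in> mspace U - mball_of U x r" for y
  proof (rule ccontr)
    assume "\<not> disjnt (mball_of U x r) (mball y r)"
    then obtain z where z: "z \<in> mball_of U x r" "z \<in> mball_of U y r"
      by (auto simp: disjnt_iff)
    then have "mball_of U x r = mball_of U z r" "mball_of U y r = mball_of U z r"
      using mball_eqI[OF \<open>0 < r\<close>] assms that by blast+
    moreover have "y \<in> mball_of U y r"
      using assms that by simp
    ultimately show False
      using that by auto
  qed
  then show ?thesis
    using assms unfolding mtopology_of_def closedin_metric by auto
qed

end

lemma in_nodes_iff: "(B, l) \<in> ball_nodes L U \<longleftrightarrow> l \<in> L \<and> (\<exists>x\<in>mspace U. B = mball_of U x l)"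
  by (simp add: ball_nodes_def)

lemma mball_in_nodes: "x \<in> mspace U \<Longrightarrow> l \<in> L \<Longrightarrow> (mball_of U x l, l) \<in> ball_nodes L U"
  by (auto simp: ball_nodes_def)

lemma nodesE:
  assumes "t \<in> ball_nodes L U"
  obtains x l where "x \<in> mspace U" "l \<in> L" "t = (mball_of U x l, l)"
  using assms by (auto simp: ball_nodes_def)

lemma nodes_F_obj [simp]: "nodes (F_obj L U) = ball_nodes L U"
  and level_F_obj [simp]: "t \<in> ball_nodes L U \<Longrightarrow> level (F_obj L U) t = snd t"
  by (auto simp: F_obj_def)

section \<open>Levels, distances and completeness\<close>

locale levels =
  fixes D L :: "real set"
  assumes D_subset: "D \<subseteq> L" and L_pos: "L \<subseteq> {0<..}"
    and above: "(\<nexists>m. is_max m D) \<or> (\<exists>m. is_max m D \<and> (\<exists>l\<in>L. l > m))"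
    and below: "(INF r\<in>D. ereal r) = 0 \<or> (\<exists>l\<in>L. ereal l \<le> (INF r\<in>D. ereal r))"
begin

text \<open>In \<open>ereal\<close> the infimum over the empty set is infinity and not 0, so for
  empty \<open>D\<close> the assumption \<open>below\<close> can hold only through a level.\<close>

lemma L_nonempty: "L \<noteq> {}"
proof (cases "D = {}")
  case True
  then show ?thesis using below by (auto simp: top_ereal_def)
next
  case False
  then show ?thesis using D_subset by blast
qed

lemma level_pos: "l \<in> L \<Longrightarrow> 0 < l"
  using L_pos by auto

text \<open>This turns assumption (i) into the source of common upper nodes: two balls merge at any
  level beyond the distance of their centres. If \<open>D\<close> has no maximum, a nonzero distance
  is exceeded by another element of \<open>D\<close>, which is a level.\<close>

lemma level_above_dist:
  assumes "U \<in> ultrametric_spaces D" and "x \<in> mspace U" and "y \<in> mspace U"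
  shows "\<exists>l\<in>L. mdist U x y < l"
proof (cases "mdist U x y = 0")
  case True
  then show ?thesis using L_nonempty level_pos by fastforce
next
  case False
  then have d: "mdist U x y \<in> D"
    using ultrametric_dist_in[OF assms] by simp
  show ?thesis
    using above
  proof
    assume "\<nexists>m. is_max m D"
    then show ?thesis
      using d D_subset unfolding is_max_def by (meson not_le subsetD)
  next
    assume "\<exists>m. is_max m D \<and> (\<exists>l\<in>L. l > m)"
    then show ?thesis
      using d unfolding is_max_def by (meson le_less_trans)
  qed
qed

text \<open>This is how assumption (ii) enters. If the infimum is 0, some element of
  \<open>D\<close> below \<open>e\<close> serves. Otherwise a level under all of \<open>D\<close>
  serves, since a distance smaller than it can only be 0.\<close>

lemma small_level:
  assumes U: "U \<in> ultrametric_spaces D" and "0 < e"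
  obtains l where "l \<in> L"
    "\<And>x y. x \<in> mspace U \<Longrightarrow> y \<in> mspace U \<Longrightarrow> mdist U x y < l \<Longrightarrow> mdist U x y < e"
  using below
proof
  assume "(INF r\<in>D. ereal r) = 0"
  then have "(INF r\<in>D. ereal r) < ereal e"
    using \<open>0 < e\<close> by simp
  then obtain l where "l \<in> D" "l < e"
    by (auto simp: INF_less_iff)
  then show thesis
    using that[of l] D_subset by auto
next
  assume "\<exists>l\<in>L. ereal l \<le> (INF r\<in>D. ereal r)"
  then obtain l where l: "l \<in> L" "\<And>r. r \<in> D \<Longrightarrow> l \<le> r"
    by (auto simp: le_INF_iff)
  have "mdist U x y < e" if "x \<in> mspace U" "y \<in> mspace U" "mdist U x y < l" for x y
    using ultrametric_dist_in[OF U that(1,2)] l(2)[of "mdist U x y"] that(3) \<open>0 < e\<close> by fastforce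
  then show thesis
    using that l(1) by blast
qed

lemma eq_if_close:
  assumes U: "U \<in> ultrametric_spaces D" and "x \<in> mspace U" and "y \<in> mspace U"
    and "\<And>l. l \<in> L \<Longrightarrow> mdist U x y < l"
  shows "x = y"
proof (rule ccontr)
  assume "x \<noteq> y"
  then have "0 < mdist U x y"
    using assms mdist_zero[of x U y] mdist_nonneg[of U x y] by linarith
  \<comment> \<open>With \<open>e\<close> equal to the distance itself, the level obtained would
    make \<open>mdist U x y\<close> smaller than itself.\<close>
  from small_level[OF U this] show False
    using assms by blast
qed

text \<open>If the two distances differed, the larger one would be nonzero, hence a level. As a
  level it separates them, being above the smaller distance but not above itself.\<close>

lemma dist_eqI:
  assumes U: "U \<in> ultrametric_spaces D" and V: "V \<in> ultrametric_spaces D"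
    and "x \<in> mspace U" "y \<in> mspace U" "x' \<in> mspace V" "y' \<in> mspace V"
    and lt: "\<And>l. l \<in> L \<Longrightarrow> mdist U x y < l \<longleftrightarrow> mdist V x' y' < l"
  shows "mdist U x y = mdist V x' y'"
proof -
  have "mdist U x y \<in> L" if "mdist U x y \<noteq> 0"
    using ultrametric_dist_in[OF U] assms that D_subset by blast
  moreover have "mdist V x' y' \<in> L" if "mdist V x' y' \<noteq> 0"
    using ultrametric_dist_in[OF V] assms that D_subset by blast
  ultimately show ?thesis
    by (metis lt mdist_nonneg less_irrefl not_less_iff_gr_or_eq not_le)
qed

text \<open>Completeness is used as the finite intersection property for closed sets among which
  there are arbitrarily small ones. A point common to all balls of the chain is a centre of each of
  them.\<close>

lemma chain_common_centre:
  assumes V: "V \<in> ultrametric_spaces D"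
    and C: "\<And>l. l \<in> L \<Longrightarrow> (C l, l) \<in> ball_nodes L V"
    and mono: "\<And>l l'. l \<in> L \<Longrightarrow> l' \<in> L \<Longrightarrow> l \<le> l' \<Longrightarrow> C l \<subseteq> C l'"
  obtains y where "y \<in> mspace V" "\<And>l. l \<in> L \<Longrightarrow> C l = mball_of V y l"
proof -
  interpret Metric_space "mspace V" "mdist V"
    by (rule Metric_space_mspace_mdist)
  have ball: "\<exists>c\<in>mspace V. C l = mball_of V c l" if "l \<in> L" for l
    using C[OF that] by (auto simp: in_nodes_iff)
  have nonempty: "C l \<noteq> {}" if l: "l \<in> L" for l
  proof -
    obtain c where "c \<in> mspace V" "C l = mball_of V c l"
      using ball[OF l] by blast
    then have "c \<in> C l"
      using level_pos[OF l] by simp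
    then show ?thesis by blast
  qed
  have closed: "\<forall>B\<in>C ` L. closedin mtopology B"
    using ball closedin_mball_of[OF V] level_pos unfolding mtopology_of_def by fastforce
  have small: "\<exists>B a. B \<in> C ` L \<and> B \<subseteq> mcball a e" if "0 < e" for e
  proof -
    obtain l where l: "l \<in> L"
      "\<And>x y. x \<in> mspace V \<Longrightarrow> y \<in> mspace V \<Longrightarrow> mdist V x y < l \<Longrightarrow> mdist V x y < e"
      using small_level[OF V \<open>0 < e\<close>] by blast
    obtain c where c: "c \<in> mspace V" "C l = mball_of V c l"
      using ball[OF l(1)] by blast
    have "C l \<subseteq> mcball c e"
      using c l(2) by (auto simp: less_imp_le)
    then show ?thesis
      using l(1) by blast
  qed
  \<comment> \<open>A nonempty finite subfamily comes from finitely many levels, and the ball at the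
    least of these lies in all the others. The empty family has intersection
    \<open>UNIV\<close>.\<close>
  have fip: "\<Inter>\<F> \<noteq> {}" if F: "finite \<F>" "\<F> \<subseteq> C ` L" for \<F>
  proof (cases "\<F> = {}")
    case False
    obtain M where M: "M \<subseteq> L" "finite M" "\<F> = C ` M"
      using finite_subset_image[OF F] by blast
    then have "M \<noteq> {}"
      using False by blast
    then have Min: "Min M \<in> L"
      using M Min_in by blast
    then have "C (Min M) \<subseteq> C l" if "l \<in> M" for l
      using that M by (intro mono) auto
    then have "C (Min M) \<subseteq> \<Inter>\<F>"
      using M(3) by blast
    moreover have "C (Min M) \<noteq> {}"
      using Min by (rule nonempty)
    ultimately show ?thesis
      by blast
  qed simp
  have "mcomplete"
    using ultrametric_complete[OF V] by (simp add: mcomplete_of_def)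
  then have "\<Inter>(C ` L) \<noteq> {}"
    unfolding mcomplete_fip by (elim allE[of _ "C ` L"] mp) (use closed small fip in simp)
  then obtain y where y: "\<And>l. l \<in> L \<Longrightarrow> y \<in> C l"
    by blast
  have "C l = mball_of V y l" if l: "l \<in> L" for l
  proof -
    obtain c where c: "c \<in> mspace V" "C l = mball_of V c l"
      using ball[OF l] by blast
    then show ?thesis
      using y[OF l] mball_eqI[OF V level_pos[OF l] c(1)] by auto
  qed
  \<comment> \<open>Any one ball of the chain places \<open>y\<close> in the carrier, and there is
    one because \<open>L\<close> is nonempty.\<close>
  moreover have "y \<in> mspace V"
    using L_nonempty y ball by fastforce
  ultimately show thesis
    using that by blast
qed

section \<open>The tree of balls\<close>

text \<open>With chosen centres the order of nodes becomes arithmetic; only the upper level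
  \<open>l'\<close> is compared with the distance.\<close>

lemma tord_F_obj_iff:
  assumes U: "U \<in> ultrametric_spaces D" and "x \<in> mspace U" "y \<in> mspace U" "l \<in> L" "l' \<in> L"
  shows "((mball_of U x l, l), (mball_of U y l', l')) \<in> tord (F_obj L U)
    \<longleftrightarrow> l \<le> l' \<and> mdist U x y < l'"
proof (cases "l \<le> l'")
  case True
  then show ?thesis
    using mball_subset_iff[OF U level_pos True] assms
    by (simp add: F_obj_def mball_in_nodes del: in_mball_of)
qed (simp add: F_obj_def)

lemma mball_node_eq_iff:
  assumes "U \<in> ultrametric_spaces D" and "x \<in> mspace U" "y \<in> mspace U" "l \<in> L"
  shows "(mball_of U x l, l) = (mball_of U y l', l') \<longleftrightarrow> l = l' \<and> mdist U x y < l"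
  using mball_eq_iff[OF assms(1) level_pos] assms by auto

lemma partial_order_F_obj: "partial_order_on (nodes (F_obj L U)) (tord (F_obj L U))"
  unfolding partial_order_on_def preorder_on_def
  by (auto simp: F_obj_def refl_on_def trans_def antisym_def)

text \<open>The left side is the exact predicate occurring both in the uniqueness axiom of trees and
  in \<open>node_above\<close>, so a rewrite with this equivalence settles either of them.\<close>

lemma tord_mball_above_iff:
  assumes U: "U \<in> ultrametric_spaces D" and x: "x \<in> mspace U" "l \<in> L"
    and l': "l' \<in> L" "l \<le> l'"
  shows "s \<in> ball_nodes L U \<and> ((mball_of U x l, l), s) \<in> tord (F_obj L U)
      \<and> level (F_obj L U) s = l' \<longleftrightarrow> s = (mball_of U x l', l')"
proof
  assume s: "s \<in> ball_nodes L U \<and> ((mball_of U x l, l), s) \<in> tord (F_obj L U)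
      \<and> level (F_obj L U) s = l'"
  then obtain y m where y: "y \<in> mspace U" "m \<in> L" "s = (mball_of U y m, m)"
    by (auto elim: nodesE)
  then have "m = l'"
    using s by auto
  moreover have "mdist U x y < m"
    using s y x tord_F_obj_iff[OF U] by auto
  ultimately show "s = (mball_of U x l', l')"
    using y mball_eq_iff[OF U level_pos[OF l'(1)] x(1) y(1)] by simp
next
  assume s: "s = (mball_of U x l', l')"
  have "mdist U x x < l'"
    using level_pos[OF l'(1)] x by simp
  then show "s \<in> ball_nodes L U \<and> ((mball_of U x l, l), s) \<in> tord (F_obj L U)
      \<and> level (F_obj L U) s = l'"
    using s assms tord_F_obj_iff[OF U] by (simp add: mball_in_nodes)
qed

lemma node_above_F_obj:
  assumes "U \<in> ultrametric_spaces D" and "x \<in> mspace U" "l \<in> L" "l' \<in> L" "l \<le> l'"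
  shows "node_above (F_obj L U) (mball_of U x l, l) l' = (mball_of U x l', l')"
  unfolding node_above_def nodes_F_obj tord_mball_above_iff[OF assms] by simp

lemma is_tree_F_obj:
  assumes U: "U \<in> ultrametric_spaces D"
  shows "is_tree L (F_obj L U)"
  unfolding is_tree_def nodes_F_obj
proof (intro conjI ballI impI)
  show "partial_order_on (ball_nodes L U) (tord (F_obj L U))"
    using partial_order_F_obj by simp
  show "level (F_obj L U) \<in> extensional (ball_nodes L U)"
    by (simp add: F_obj_def)
  obtain x where "x \<in> mspace U"
    using ultrametric_nonempty[OF U] by blast
  then show "level (F_obj L U) ` ball_nodes L U = L"
    by (force simp: ball_nodes_def F_obj_def image_iff)
next
  fix t t'
  assume "t \<in> ball_nodes L U" "t' \<in> ball_nodes L U"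
  then obtain x l y l' where t: "x \<in> mspace U" "l \<in> L" "t = (mball_of U x l, l)"
    and t': "y \<in> mspace U" "l' \<in> L" "t' = (mball_of U y l', l')"
    by (elim nodesE)
  have nodes: "t \<in> ball_nodes L U" "t' \<in> ball_nodes L U"
    by fact+
  note order = tord_F_obj_iff[OF U]
  show "level (F_obj L U) t < level (F_obj L U) t'"
    if "(t, t') \<in> tord (F_obj L U) \<and> t \<noteq> t'"
    using that t t' nodes mball_eq_iff[OF U level_pos] by (force simp: order)
  show "\<exists>k\<in>L. max (level (F_obj L U) t) (level (F_obj L U) t') \<le> k \<and>
        (\<exists>s\<in>ball_nodes L U. (t, s) \<in> tord (F_obj L U) \<and> (t', s) \<in> tord (F_obj L U) \<and>
           level (F_obj L U) s = k)"
  proof -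
    obtain m where m: "m \<in> L" "mdist U x y < m"
      using level_above_dist[OF U] t t' by blast
    \<comment> \<open>This level lies above both nodes and beyond the distance of their centres, so
      the two balls of radius \<open>k\<close> coincide.\<close>
    define k where "k = Max {l, l', m}"
    have k: "k \<in> L" "l \<le> k" "l' \<le> k" "m \<le> k"
      using t t' m Max_in[of "{l, l', m}"] by (auto simp: k_def)
    have "mball_of U x k = mball_of U y k"
      using mball_eq_iff[OF U level_pos[OF k(1)]] t t' m k by auto
    then have "(mball_of U x k, k) \<in> ball_nodes L U" "(t, (mball_of U x k, k)) \<in> tord (F_obj L U)"
      "(t', (mball_of U x k, k)) \<in> tord (F_obj L U)" "level (F_obj L U) (mball_of U x k, k) = k"
      using tord_mball_above_iff[OF U t(1,2) k(1,2), of "(mball_of U x k, k)"]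
        tord_mball_above_iff[OF U t'(1,2) k(1,3), of "(mball_of U x k, k)"] t(3) t'(3) by simp_all
    moreover have "max (level (F_obj L U) t) (level (F_obj L U) t') \<le> k"
      using k t t' nodes by simp
    ultimately show ?thesis
      using k(1) by blast
  qed
  show "\<exists>m. is_max m {k \<in> L. max (level (F_obj L U) t) (level (F_obj L U) t') \<le> k \<and>
                 node_above (F_obj L U) t k \<noteq> node_above (F_obj L U) t' k}"
    if "(t, t') \<notin> tord (F_obj L U) \<and> (t', t) \<notin> tord (F_obj L U)"
  proof -
    \<comment> \<open>Whichever of \<open>l\<close> and \<open>l'\<close> is larger, failure of the
      comparison towards it bounds the distance from below. The distance is then nonzero, hence a
      level, and it is the required maximum: balls of radius \<open>k\<close> around
      \<open>x\<close> and \<open>y\<close> differ exactly when \<open>k\<close> is at most the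
      distance.\<close>
    have d: "max l l' \<le> mdist U x y"
      using that t t' by (auto simp: order mdist_commute[of U y x])
    then have "mdist U x y \<noteq> 0"
      using level_pos[OF t(2)] by auto
    then have dL: "mdist U x y \<in> L"
      using ultrametric_dist_in[OF U] t t' D_subset by blast
    have "{k \<in> L. max (level (F_obj L U) t) (level (F_obj L U) t') \<le> k \<and>
                 node_above (F_obj L U) t k \<noteq> node_above (F_obj L U) t' k}
      = {k \<in> L. max l l' \<le> k \<and> k \<le> mdist U x y}"
      using t t' nodes mball_eq_iff[OF U level_pos] by (auto simp: node_above_F_obj[OF U] not_less)
    then show ?thesis
      using d dL by (auto simp: is_max_def)
  qed
next
  fix t k
  assume t: "t \<in> ball_nodes L U" and k: "k \<in> L" "level (F_obj L U) t \<le> k"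
  obtain x l where x: "x \<in> mspace U" "l \<in> L" "t = (mball_of U x l, l)"
    using t by (rule nodesE)
  then have "l \<le> k"
    using k t by simp
  show "\<exists>!s. s \<in> ball_nodes L U \<and> (t, s) \<in> tord (F_obj L U) \<and> level (F_obj L U) s = k"
    unfolding x(3) tord_mball_above_iff[OF U x(1,2) k(1) \<open>l \<le> k\<close>] by simp
qed

lemma pruned_F_obj:
  assumes U: "U \<in> ultrametric_spaces D"
  shows "pruned L (F_obj L U)"
  unfolding pruned_def
proof
  fix t
  assume "t \<in> nodes (F_obj L U)"
  then obtain x l where x: "x \<in> mspace U" "l \<in> L" "t = (mball_of U x l, l)"
    by (auto elim: nodesE)
  have "is_branch L (F_obj L U) (\<lambda>k. (mball_of U x k, k))"
    using x level_pos by (auto simp: is_branch_def mball_in_nodes tord_F_obj_iff[OF U])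
  then show "\<exists>b. is_branch L (F_obj L U) b \<and> t \<in> b ` L"
    using x by blast
qed

section \<open>The action on isometric embeddings\<close>

text \<open>This removes the arbitrary choice made in \<open>F_arr\<close>. Two points of
  \<open>B\<close> are at distance less than \<open>l\<close>, their images are equally close, and
  so these are centres of the same ball.\<close>

lemma F_arr_eq:
  assumes U: "U \<in> ultrametric_spaces D" and V: "V \<in> ultrametric_spaces D"
    and \<psi>: "\<psi> \<in> isometric_embeddings U V"
    and B: "(B, l) \<in> ball_nodes L U" and x: "x \<in> B"
  shows "F_arr L U V \<psi> (B, l) = (mball_of V (\<psi> x) l, l)"
proof -
  obtain c where c: "c \<in> mspace U" "l \<in> L" "B = mball_of U c l"
    using B by (auto simp: in_nodes_iff)
  define y where "y = (SOME x. x \<in> B)"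
  have y: "y \<in> B"
    unfolding y_def using x by (rule someI)
  have mem: "x \<in> mspace U" "y \<in> mspace U"
    using x y c by auto
  have "mball_of U y l = B" "mball_of U x l = B"
    using mball_eqI[OF U level_pos[OF c(2)] c(1)] x y c by blast+
  then have "mdist U y x < l"
    using mball_eq_iff[OF U level_pos[OF c(2)] mem(2,1)] by simp
  then have "mball_of V (\<psi> y) l = mball_of V (\<psi> x) l"
    using mem mball_eq_iff[OF V level_pos[OF c(2)]] \<psi>
    by (simp add: isometric_embeddings_in isometric_embeddings_dist)
  then show ?thesis
    using B by (simp add: F_arr_def y_def)
qed

lemma F_arr_mball:
  assumes "U \<in> ultrametric_spaces D" and "V \<in> ultrametric_spaces D"
    and "\<psi> \<in> isometric_embeddings U V" and "x \<in> mspace U" and "l \<in> L"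
  shows "F_arr L U V \<psi> (mball_of U x l, l) = (mball_of V (\<psi> x) l, l)"
  using assms level_pos[of l] by (intro F_arr_eq) (auto simp: mball_in_nodes)

text \<open>Order and equality of nodes depend only on levels and on distances of centres, and both
  are preserved.\<close>

lemma F_arr_in_tree_embeddings:
  assumes U: "U \<in> ultrametric_spaces D" and V: "V \<in> ultrametric_spaces D"
    and \<psi>: "\<psi> \<in> isometric_embeddings U V"
  shows "F_arr L U V \<psi> \<in> tree_embeddings (F_obj L U) (F_obj L V)"
proof -
  note arr = F_arr_mball[OF U V \<psi>]
  note [simp] = isometric_embeddings_in[OF \<psi>] isometric_embeddings_dist[OF \<psi>] mball_in_nodes
  have maps: "F_arr L U V \<psi> t \<in> ball_nodes L V \<and> snd (F_arr L U V \<psi> t) = snd t"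
    if "t \<in> ball_nodes L U" for t
    using that by (elim nodesE) (simp add: arr)
  have "inj_on (F_arr L U V \<psi>) (ball_nodes L U)"
  proof (rule inj_onI)
    fix s t
    assume "s \<in> ball_nodes L U" "t \<in> ball_nodes L U" "F_arr L U V \<psi> s = F_arr L U V \<psi> t"
    then show "s = t"
      by (elim nodesE) (simp add: arr mball_node_eq_iff[OF U] mball_node_eq_iff[OF V]
          del: prod.inject)
  qed
  moreover have "(t, s) \<in> tord (F_obj L U)
      \<longleftrightarrow> (F_arr L U V \<psi> t, F_arr L U V \<psi> s) \<in> tord (F_obj L V)"
    if "t \<in> ball_nodes L U" "s \<in> ball_nodes L U" for t s
    using that by (elim nodesE) (simp add: arr tord_F_obj_iff[OF U] tord_F_obj_iff[OF V])
  ultimately show ?thesis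
    using maps unfolding tree_embeddings_def
    by (auto simp: PiE_iff F_arr_def simp del: prod.inject)
qed

lemma F_arr_full:
  assumes U: "U \<in> ultrametric_spaces D" and V: "V \<in> ultrametric_spaces D"
    and k: "k \<in> tree_embeddings (F_obj L U) (F_obj L V)"
  shows "\<exists>\<psi>\<in>isometric_embeddings U V. F_arr L U V \<psi> = k"
proof -
  have maps: "k t \<in> ball_nodes L V" "snd (k t) = snd t" if "t \<in> ball_nodes L U" for t
    using k that by (auto simp: tree_embeddings_def PiE_iff)
  have order: "(t, s) \<in> tord (F_obj L U) \<longleftrightarrow> (k t, k s) \<in> tord (F_obj L V)"
    if "t \<in> ball_nodes L U" "s \<in> ball_nodes L U" for t s
    using k that by (auto simp: tree_embeddings_def)
  have "\<exists>y. y \<in> mspace V \<and> (\<forall>l\<in>L. k (mball_of U x l, l) = (mball_of V y l, l))"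
    if x: "x \<in> mspace U" for x
  proof -
    \<comment> \<open>The balls around \<open>x\<close> form a branch; \<open>C\<close> is its image
      under \<open>k\<close>, again one ball for each level.\<close>
    define C where "C = (\<lambda>l. fst (k (mball_of U x l, l)))"
    have kC: "k (mball_of U x l, l) = (C l, l)" if "l \<in> L" for l
      using maps(2)[of "(mball_of U x l, l)"] x that by (simp add: C_def prod_eq_iff mball_in_nodes)
    have "(C l, l) \<in> ball_nodes L V" if "l \<in> L" for l
      using maps(1)[of "(mball_of U x l, l)"] x that kC by (simp add: mball_in_nodes)
    moreover have "C l \<subseteq> C l'" if "l \<in> L" "l' \<in> L" "l \<le> l'" for l l'
    proof -
      have "((mball_of U x l, l), (mball_of U x l', l')) \<in> tord (F_obj L U)"
        using x that level_pos by (simp add: tord_F_obj_iff[OF U])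
      then have "((C l, l), (C l', l')) \<in> tord (F_obj L V)"
        using order x that kC by (simp add: mball_in_nodes)
      then show ?thesis
        by (simp add: F_obj_def)
    qed
    ultimately obtain y where "y \<in> mspace V" "\<And>l. l \<in> L \<Longrightarrow> C l = mball_of V y l"
      using chain_common_centre[OF V] by blast
    then show ?thesis
      using kC by auto
  qed
  then obtain f where f: "\<And>x. x \<in> mspace U \<Longrightarrow> f x \<in> mspace V"
    "\<And>x l. x \<in> mspace U \<Longrightarrow> l \<in> L \<Longrightarrow> k (mball_of U x l, l) = (mball_of V (f x) l, l)"
    by metis
  define \<psi> where "\<psi> = restrict f (mspace U)"
  have "mdist V (f x) (f y) = mdist U x y" if xy: "x \<in> mspace U" "y \<in> mspace U" for x y
  proof (rule dist_eqI[OF V U])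
    fix l
    assume l: "l \<in> L"
    \<comment> \<open>Between two balls of the same level \<open>l\<close> the order relation says
      just that the centres are closer than \<open>l\<close>, and \<open>k\<close> both preserves
      and reflects the order.\<close>
    show "mdist V (f x) (f y) < l \<longleftrightarrow> mdist U x y < l"
      using order[of "(mball_of U x l, l)" "(mball_of U y l, l)"] xy l f
      by (simp add: mball_in_nodes tord_F_obj_iff[OF U] tord_F_obj_iff[OF V])
  qed (use xy f in auto)
  then have \<psi>: "\<psi> \<in> isometric_embeddings U V"
    using f by (simp add: isometric_embeddings_def \<psi>_def)
  moreover have "F_arr L U V \<psi> = k"
  proof (rule extensionalityI[of _ "ball_nodes L U"])
    show "F_arr L U V \<psi> \<in> extensional (ball_nodes L U)"
      by (simp add: F_arr_def)
    show "k \<in> extensional (ball_nodes L U)"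
      using k by (simp add: tree_embeddings_def PiE_def)
    show "F_arr L U V \<psi> t = k t" if "t \<in> ball_nodes L U" for t
      using that by (elim nodesE) (simp add: F_arr_mball[OF U V \<psi>] f, simp add: \<psi>_def)
  qed
  ultimately show ?thesis by blast
qed

text \<open>If the tree maps agree, the two images of \<open>x\<close> are centres of the same ball
  at every level, and points that close are equal.\<close>

lemma F_arr_inj:
  assumes U: "U \<in> ultrametric_spaces D" and V: "V \<in> ultrametric_spaces D"
  shows "inj_on (F_arr L U V) (isometric_embeddings U V)"
proof (rule inj_onI)
  fix \<phi> \<psi>
  assume \<phi>: "\<phi> \<in> isometric_embeddings U V" and \<psi>: "\<psi> \<in> isometric_embeddings U V"
    and eq: "F_arr L U V \<phi> = F_arr L U V \<psi>"
  show "\<phi> = \<psi>"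
  proof (rule extensionalityI[of _ "mspace U"])
    show "\<phi> \<in> extensional (mspace U)" "\<psi> \<in> extensional (mspace U)"
      using \<phi> \<psi> by (auto simp: isometric_embeddings_def PiE_def)
    fix x
    assume x: "x \<in> mspace U"
    have mem: "\<phi> x \<in> mspace V" "\<psi> x \<in> mspace V"
      using isometric_embeddings_in[OF \<phi> x] isometric_embeddings_in[OF \<psi> x] .
    then show "\<phi> x = \<psi> x"
    proof (rule eq_if_close[OF V])
      fix l
      assume l: "l \<in> L"
      have "mball_of V (\<phi> x) l = mball_of V (\<psi> x) l"
        using F_arr_mball[OF U V \<phi> x l] F_arr_mball[OF U V \<psi> x l] eq by simp
      then show "mdist V (\<phi> x) (\<psi> x) < l"
        using mball_eq_iff[OF V level_pos[OF l] mem] by simp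
    qed
  qed
qed

section \<open>Injectivity on objects and the full embedding\<close>

text \<open>Nodes carry actual subsets of the carrier, so equal trees come with literally the same
  balls. These give back first the points and then, through \<open>dist_eqI\<close>, the
  distances.\<close>

lemma F_obj_inj: "inj_on (F_obj L) (ultrametric_spaces D)"
proof (rule inj_onI)
  fix U V :: "'a metric"
  assume U: "U \<in> ultrametric_spaces D" and V: "V \<in> ultrametric_spaces D"
    and eq: "F_obj L U = F_obj L V"
  have nodes: "ball_nodes L U = ball_nodes L V"
    using eq by (metis nodes_F_obj)
  have half: "mspace A \<subseteq> mspace B \<and> (\<forall>x\<in>mspace A. \<forall>l\<in>L. mball_of A x l = mball_of B x l)"
    if B: "B \<in> ultrametric_spaces D" and eq: "ball_nodes L A = ball_nodes L B"
    for A B :: "'a metric"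
  proof -
    have "x \<in> mspace B \<and> mball_of A x l = mball_of B x l"
      if x: "x \<in> mspace A" and l: "l \<in> L" for x l
    proof -
      have "(mball_of A x l, l) \<in> ball_nodes L B"
        using mball_in_nodes[OF x l] eq by simp
      then obtain c where c: "c \<in> mspace B" "mball_of A x l = mball_of B c l"
        by (auto simp: in_nodes_iff)
      \<comment> \<open>The ball, seen in \<open>B\<close>, has some centre \<open>c\<close>; as it
        contains \<open>x\<close>, the point \<open>x\<close> is a centre in \<open>B\<close>
        too.\<close>
      moreover have "x \<in> mball_of A x l"
        using x level_pos[OF l] by simp
      ultimately show ?thesis
        using mball_eqI[OF B level_pos[OF l] c(1)] by auto
    qed
    then show ?thesis
      using L_nonempty by blast
  qed
  have sp: "mspace U = mspace V"
    using half[OF V nodes] half[OF U nodes[symmetric]] by blast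
  have balls: "mball_of U x l = mball_of V x l" if "x \<in> mspace U" "l \<in> L" for x l
    using half[OF V nodes] that by blast
  show "U = V"
  proof (rule metric_eqI[OF sp], intro ext)
    fix x y
    show "mdist U x y = mdist V x y"
    proof (cases "x \<in> mspace U \<and> y \<in> mspace U")
      case True
      then have xy: "x \<in> mspace V" "y \<in> mspace V"
        using sp by auto
      have "mdist U x y < l \<longleftrightarrow> mdist V x y < l" if "l \<in> L" for l
      proof -
        have "y \<in> mball_of U x l \<longleftrightarrow> y \<in> mball_of V x l"
          using balls that True by simp
        then show ?thesis
          using True xy by simp
      qed
      then show ?thesis
        using dist_eqI[OF U V] True xy by blast
    next
      case False
      \<comment> \<open>Off the carrier both distance functions are 0 by the convention in
        \<open>ultrametric_spaces\<close>.\<close>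
      then show ?thesis
        using ultrametric_dist_off[OF U] ultrametric_dist_off[OF V] sp by metis
    qed
  qed
qed

lemma categorical_full_embedding_F:
  "categorical_full_embedding (U_cat D) (T_pr_cat L) (F_obj L) (F_arr L)"
proof -
  interpret S: category "U_cat D"
    by (rule category_ultrametric_spaces)
  interpret T: category "T_pr_cat L"
    by (rule category_pruned_trees)
  have [simp]: "Ob (U_cat D) = ultrametric_spaces D" "Hom (U_cat D) = isometric_embeddings"
    "Ident (U_cat D) U = restrict id (mspace U)"
    "Comp (U_cat D) U V W g f = compose (mspace U) g f" for U V W f g
    by (simp_all add: U_cat_def)
  have [simp]: "Ob (T_pr_cat L) = {T. is_tree L T \<and> pruned L T}"
    "Hom (T_pr_cat L) = tree_embeddings"
    "Ident (T_pr_cat L) X = restrict id (nodes X)"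
    "Comp (T_pr_cat L) X Y Z g' f' = compose (nodes X) g' f'" for X Y Z f' g'
    by (simp_all add: T_pr_cat_def)
  show ?thesis
  proof unfold_locales
    fix U
    assume "U \<in> Ob (U_cat D)"
    then have U: "U \<in> ultrametric_spaces D"
      by simp
    show "F_obj L U \<in> Ob (T_pr_cat L)"
      using is_tree_F_obj[OF U] pruned_F_obj[OF U] by simp
    have id: "restrict id (mspace U) \<in> isometric_embeddings U U"
      using S.Ident_in_Hom[of U] U by simp
    have "F_arr L U U (restrict id (mspace U)) = restrict id (ball_nodes L U)"
    proof (rule extensionalityI[of _ "ball_nodes L U"])
      show "F_arr L U U (restrict id (mspace U)) t = restrict id (ball_nodes L U) t"
        if "t \<in> ball_nodes L U" for t
        using that by (elim nodesE) (simp add: F_arr_mball[OF U U id] mball_in_nodes)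
    qed (auto simp: F_arr_def)
    then show "F_arr L U U (Ident (U_cat D) U) = Ident (T_pr_cat L) (F_obj L U)"
      by simp
  next
    fix U V f
    assume "U \<in> Ob (U_cat D)" "V \<in> Ob (U_cat D)" "f \<in> Hom (U_cat D) U V"
    then show "F_arr L U V f \<in> Hom (T_pr_cat L) (F_obj L U) (F_obj L V)"
      using F_arr_in_tree_embeddings by simp
  next
    fix U V W f g
    assume *: "U \<in> Ob (U_cat D)" "V \<in> Ob (U_cat D)" "W \<in> Ob (U_cat D)"
      "f \<in> Hom (U_cat D) U V" "g \<in> Hom (U_cat D) V W"
    then have U: "U \<in> ultrametric_spaces D" and V: "V \<in> ultrametric_spaces D"
      and W: "W \<in> ultrametric_spaces D"
      and f: "f \<in> isometric_embeddings U V" and g: "g \<in> isometric_embeddings V W"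
      by simp_all
    have gf: "compose (mspace U) g f \<in> isometric_embeddings U W"
      using S.Comp_in_Hom[OF *] by simp
    have "F_arr L U W (compose (mspace U) g f)
        = compose (ball_nodes L U) (F_arr L V W g) (F_arr L U V f)"
    proof (rule extensionalityI[of _ "ball_nodes L U"])
      show "F_arr L U W (compose (mspace U) g f) t
          = compose (ball_nodes L U) (F_arr L V W g) (F_arr L U V f) t"
        if "t \<in> ball_nodes L U" for t
        using that by (elim nodesE)
          (simp add: F_arr_mball[OF U V f] F_arr_mball[OF V W g] F_arr_mball[OF U W gf]
            mball_in_nodes compose_eq isometric_embeddings_in[OF f])
    qed (auto simp: F_arr_def)
    then show "F_arr L U W (Comp (U_cat D) U V W g f)
        = Comp (T_pr_cat L) (F_obj L U) (F_obj L V) (F_obj L W)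
            (F_arr L V W g) (F_arr L U V f)"
      by simp
  qed (use F_arr_inj F_arr_full F_obj_inj in auto)
qed

section \<open>The cardinality bound\<close>

text \<open>A node is coded by its level and a nonempty basic open set inside its ball, taken from a
  base of least cardinality. The code is injective because balls of equal radius that share a point
  coincide.\<close>

lemma card_of_nodes_le:
  assumes U: "U \<in> ultrametric_spaces D"
  shows "|ball_nodes L U| \<le>o weight (mtopology_of U) *c |L|"
proof -
  interpret Metric_space "mspace U" "mdist U"
    by (rule Metric_space_mspace_mdist)
  obtain \<B> where \<B>: "base_of (mtopology_of U) \<B>" "weight (mtopology_of U) = |\<B>|"
    by (rule weight_least_base)
  have "\<exists>V\<in>\<B>. V \<noteq> {} \<and> V \<subseteq> fst t" if t: "t \<in> ball_nodes L U" for t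
  proof -
    obtain x l where x: "x \<in> mspace U" "l \<in> L" "t = (mball_of U x l, l)"
      using t by (rule nodesE)
    then have "x \<in> fst t"
      using level_pos by simp
    moreover have "openin (mtopology_of U) (fst t)"
      using x by (simp add: mtopology_of_def mball_of_def)
    ultimately show ?thesis
      using \<B>(1) unfolding base_of_def by blast
  qed
  then obtain g where g: "\<And>t. t \<in> ball_nodes L U \<Longrightarrow> g t \<in> \<B> \<and> g t \<noteq> {} \<and> g t \<subseteq> fst t"
    by metis
  have "inj_on (\<lambda>t. (g t, snd t)) (ball_nodes L U)"
  proof (rule inj_onI)
    fix s t
    assume s: "s \<in> ball_nodes L U" and t: "t \<in> ball_nodes L U"
      and eq: "(g s, snd s) = (g t, snd t)"
    obtain x l where x: "x \<in> mspace U" "l \<in> L" "s = (mball_of U x l, l)"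
      using s by (rule nodesE)
    obtain y where y: "y \<in> mspace U" "t = (mball_of U y l, l)"
      using t eq x by (auto elim: nodesE)
    \<comment> \<open>Nonemptiness of the shared basic set is what forces the two balls to
      meet.\<close>
    have "g s \<subseteq> mball_of U x l" "g s \<subseteq> mball_of U y l" "g s \<noteq> {}"
      using g[OF s] g[OF t] eq x(3) y(2) by simp_all
    then obtain z where "z \<in> mball_of U x l" "z \<in> mball_of U y l"
      by blast
    then have "mball_of U x l = mball_of U z l" "mball_of U y l = mball_of U z l"
      using mball_eqI[OF U level_pos[OF x(2)]] x y by blast+
    then show "s = t"
      using x y by simp
  qed
  moreover have "(\<lambda>t. (g t, snd t)) ` ball_nodes L U \<subseteq> \<B> \<times> L"
    using g by (auto simp: ball_nodes_def)
  ultimately have "|ball_nodes L U| \<le>o |\<B> \<times> L|"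
    using card_of_ordLeq by blast
  then show ?thesis
    by (simp add: \<B>(2) cprod_def Field_card_of)
qed

end

theorem theorem4p7:
  fixes D L :: "real set"
  assumes "D \<subseteq> L" and "L \<subseteq> {0<..}"
    and "(\<nexists>m. is_max m D) \<or> (\<exists>m. is_max m D \<and> (\<exists>l\<in>L. l > m))"
    and "(INF r\<in>D. ereal r) = 0 \<or> (\<exists>l\<in>L. ereal l \<le> (INF r\<in>D. ereal r))"
  shows "(\<forall>U \<in> Ob (U_cat D :: ('a metric, 'a \<Rightarrow> 'a) cat). \<forall>V \<in> Ob (U_cat D).
            \<forall>\<psi> \<in> Hom (U_cat D) U V. \<forall>B l x. (B, l) \<in> nodes (F_obj L U) \<and> x \<in> B \<longrightarrow>
              F_arr L U V \<psi> (B, l) = (mball_of V (\<psi> x) l, l))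
       \<and> categorical_full_embedding (U_cat D :: ('a metric, 'a \<Rightarrow> 'a) cat) (T_pr_cat L)
            (F_obj L) (F_arr L)
       \<and> (\<forall>U \<in> Ob (U_cat D :: ('a metric, 'a \<Rightarrow> 'a) cat).
            |nodes (F_obj L U)| \<le>o weight (mtopology_of U) *c |L| )"
proof -
  interpret levels D L
    by (rule levels.intro) (fact assms)+
  have cat: "Ob (U_cat D) = ultrametric_spaces D" "Hom (U_cat D) = isometric_embeddings"
    by (simp_all add: U_cat_def)
  show ?thesis
    unfolding cat nodes_F_obj
  proof (intro conjI ballI allI impI)
    fix U V :: "'a metric" and \<psi> B l x
    assume "U \<in> ultrametric_spaces D" "V \<in> ultrametric_spaces D"
      "\<psi> \<in> isometric_embeddings U V" "(B, l) \<in> ball_nodes L U \<and> x \<in> B"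
    then show "F_arr L U V \<psi> (B, l) = (mball_of V (\<psi> x) l, l)"
      by (intro F_arr_eq) auto
  qed (fact categorical_full_embedding_F, rule card_of_nodes_le)
qed

end
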